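(* Let $X\subset\mathbb{R}^3$ be a smooth tropical quadric surface, i.e. a smooth tropical surface of degree $2$. Then $X$ has a unique compact $2$-cell. Moreover, this cell has a normal vector of the form $-e_i+e_j+e_k$ for some permutation $(i,j,k)$ of $(1,2,3)$, where $e_1,e_2,e_3$ is the standard basis of $\mathbb{R}^3$.
   Context: A tropical polynomial in three variables is a function $f(x)=\max_{a\in\mathcal{A}}\{\lambda_a+\langle a,x\rangle\}$ on $\mathbb{R}^3$, with $\mathcal{A}\subset\mathbb{Z}_{\ge 0}^3$ finite and $\lambda_a\in\mathbb{R}$. The tropical surface $V_{tr}(f)\subset\mathbb{R}^3$ is the set of points where the maximum is attained at least twice. $\operatorname{conv}(\mathcal{A})$ is the Newton polytope of $f$, and $\operatorname{Subdiv}(f)$ is the subdivision of it obtained by projecting the upper (top) faces of $\operatorname{conv}\{(a,\lambda_a): a\in\mathcal{A}\}\subset\mathbb{R}^4$ to $\mathbb{R}^3$. $V_{tr}(f)$ is a polyhedral complex of pure dimension 2 whose (closed) cells are the sets $\Delta^\vee$, for $\Delta\in\operatorname{Subdiv}(f)$ of dimension $\geq 1$: if $\Delta$ has vertices $a_1,\dots,a_r$, then $\Delta^\vee=\{x:\lambda_{a_1}+\langle a_1,x\rangle=\dots=\lambda_{a_r}+\langle a_r,x\rangle\ge\lambda_b+\langle b,x\rangle\ \forall b\in\mathcal{A}\}$, of dimension $3-\dim\Delta$. For a positive integer $\delta$ let $\Gamma_\delta=\operatorname{conv}\{(0,0,0),(\delta,0,0),(0,\delta,0),(0,0,\delta)\}$.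 The surface $X=V_{tr}(f)$ has degree $\delta$ if the Newton polytope of $f$ is $\Gamma_\delta$, and it is smooth if moreover $\operatorname{Subdiv}(f)$ is an elementary (unimodular) triangulation of $\Gamma_\delta$, i.e. all its maximal elements are lattice tetrahedra of volume $\frac16$. *)

theory Defs
  imports "HOL-Analysis.Analysis"
begin

text \<open>
  A tropical polynomial \<open>f(x) = max {lam a + a \<bullet> x | a \<in> A}\<close> on \<open>real ^ 3\<close> is given by its exponent
  set \<open>A\<close> (nonnegative integer points, embedded in \<open>real ^ 3\<close>) and its coefficients \<open>lam\<close>; only the
  values of \<open>lam\<close> on \<open>A\<close> matter.
\<close>

definition tropical_exponents :: "(real^3) set \<Rightarrow> bool" where
  "tropical_exponents A \<longleftrightarrow> finite A \<and> A \<noteq> {} \<and> (\<forall>a\<in>A. \<forall>i. a $ i \<in> \<nat>)"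

definition trop_term :: "(real^3 \<Rightarrow> real) \<Rightarrow> real^3 \<Rightarrow> real^3 \<Rightarrow> real" where
  "trop_term lam a x = lam a + a \<bullet> x"

definition trop_eval :: "(real^3) set \<Rightarrow> (real^3 \<Rightarrow> real) \<Rightarrow> real^3 \<Rightarrow> real" where
  "trop_eval A lam x = Max ((\<lambda>a. trop_term lam a x) ` A)"

definition V_tr :: "(real^3) set \<Rightarrow> (real^3 \<Rightarrow> real) \<Rightarrow> (real^3) set" where
  "V_tr A lam = {x. \<exists>a\<in>A. \<exists>b\<in>A. a \<noteq> b \<and>
     trop_term lam a x = trop_eval A lam x \<and> trop_term lam b x = trop_eval A lam x}"

definition newton_polytope :: "(real^3) set \<Rightarrow> (real^3) set" where
  "newton_polytope A = convex hull A"

definition lifted_polytope :: "(real^3) set \<Rightarrow> (real^3 \<Rightarrow> real) \<Rightarrow> ((real^3) \<times> real) set" where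
  "lifted_polytope A lam = convex hull ((\<lambda>a. (a, lam a)) ` A)"

text \<open>
  Upper faces are the nonempty faces having an outer normal vector with positive last coordinate
  (compare \<^const>\<open>exposed_face_of\<close>; faces of a polytope are exposed).
\<close>

definition upper_face_of :: "((real^3) \<times> real) set \<Rightarrow> ((real^3) \<times> real) set \<Rightarrow> bool"
    (infixr \<open>(upper'_face'_of)\<close> 50) where
  "F upper_face_of P \<longleftrightarrow> F face_of P \<and> F \<noteq> {} \<and>
     (\<exists>u c r. c > 0 \<and> P \<subseteq> {z. (u, c) \<bullet> z \<le> r} \<and> F = P \<inter> {z. (u, c) \<bullet> z = r})"

definition Subdiv :: "(real^3) set \<Rightarrow> (real^3 \<Rightarrow> real) \<Rightarrow> (real^3) set set" where
  "Subdiv A lam = {fst ` F | F. F upper_face_of lifted_polytope A lam}"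

definition dual_cell :: "(real^3) set \<Rightarrow> (real^3 \<Rightarrow> real) \<Rightarrow> (real^3) set \<Rightarrow> (real^3) set" where
  "dual_cell A lam D =
     {x. (\<forall>a a'. a extreme_point_of D \<longrightarrow> a' extreme_point_of D \<longrightarrow>
             trop_term lam a x = trop_term lam a' x) \<and>
         (\<forall>a b. a extreme_point_of D \<longrightarrow> b \<in> A \<longrightarrow> trop_term lam b x \<le> trop_term lam a x)}"

definition tropical_cells :: "(real^3) set \<Rightarrow> (real^3 \<Rightarrow> real) \<Rightarrow> (real^3) set set" where
  "tropical_cells A lam = {dual_cell A lam D | D. D \<in> Subdiv A lam \<and> aff_dim D \<ge> 1}"

definition Gamma_simplex :: "nat \<Rightarrow> (real^3) set" where
  "Gamma_simplex d = convex hull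
     {vector [0, 0, 0], vector [real d, 0, 0], vector [0, real d, 0], vector [0, 0, real d]}"

definition unimodular_tetrahedron :: "(real^3) set \<Rightarrow> bool" where
  "unimodular_tetrahedron D \<longleftrightarrow> 3 simplex D \<and>
     (\<forall>v. v extreme_point_of D \<longrightarrow> (\<forall>i. v $ i \<in> \<int>)) \<and> measure lborel D = 1 / 6"

definition unimodular_triangulation :: "(real^3) set set \<Rightarrow> bool" where
  "unimodular_triangulation S \<longleftrightarrow>
     (\<forall>D\<in>S. (\<forall>D'\<in>S. D \<subseteq> D' \<longrightarrow> D' = D) \<longrightarrow> unimodular_tetrahedron D)"

text \<open>
  \<open>X\<close> is a smooth tropical surface of degree \<open>d\<close>, presented by the tropical polynomial \<open>(A, lam)\<close>.
\<close>

definition smooth_tropical_surface ::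
    "nat \<Rightarrow> (real^3) set \<Rightarrow> (real^3 \<Rightarrow> real) \<Rightarrow> (real^3) set \<Rightarrow> bool" where
  "smooth_tropical_surface d A lam X \<longleftrightarrow>
     d > 0 \<and> tropical_exponents A \<and> X = V_tr A lam \<and>
     newton_polytope A = Gamma_simplex d \<and> unimodular_triangulation (Subdiv A lam)"

definition normal_vector_of :: "real^3 \<Rightarrow> (real^3) set \<Rightarrow> bool" where
  "normal_vector_of n C \<longleftrightarrow> n \<noteq> 0 \<and> (\<forall>x\<in>C. \<forall>y\<in>C. n \<bullet> (x - y) = 0)"

text \<open>The cells of \<open>(A, lam)\<close> cover exactly the tropical surface.\<close>

lemma Subdiv_hull:
  assumes "finite A" "D \<in> Subdiv A lam"
  obtains B where "B \<subseteq> A" "D = convex hull B"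
proof -
  obtain F where F: "D = fst ` F" "F face_of convex hull ((\<lambda>a. (a, lam a)) ` A)"
    using assms(2) unfolding Subdiv_def upper_face_of_def lifted_polytope_def by auto
  have comp: "compact ((\<lambda>a. (a, lam a)) ` A)"
    using assms(1) by (simp add: finite_imp_compact)
  obtain S where S: "S \<subseteq> (\<lambda>a. (a, lam a)) ` A" "F = convex hull S"
    by (rule face_of_convex_hull_subset[OF comp F(2)])
  have "D = convex hull (fst ` S)"
    using F(1) S(2) convex_hull_linear_image[OF linear_fst, of S] by simp
  moreover have "fst ` S \<subseteq> A" using S(1) by auto
  ultimately show ?thesis using that by blast
qed

lemma Union_tropical_cells:
  assumes "tropical_exponents A"
  shows "\<Union>(tropical_cells A lam) = V_tr A lam"
proof -
  have fin: "finite A" and ne: "A \<noteq> {}" using assms by (auto simp: tropical_exponents_def)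
  have le_eval: "trop_term lam b x \<le> trop_eval A lam x" if "b \<in> A" for b x
    using fin that by (simp add: trop_eval_def)
  show ?thesis
  proof (intro equalityI subsetI)
    fix x assume "x \<in> \<Union>(tropical_cells A lam)"
    then obtain D where D: "D \<in> Subdiv A lam" "aff_dim D \<ge> 1" "x \<in> dual_cell A lam D"
      by (auto simp: tropical_cells_def)
    obtain B where B: "B \<subseteq> A" "D = convex hull B" using Subdiv_hull[OF fin D(1)] .
    have ext: "v \<in> A" if "v extreme_point_of D" for v
      using that B extreme_point_of_convex_hull by blast
    have "finite B" using B(1) fin finite_subset by blast
    then have KM: "D = convex hull {v. v extreme_point_of D}"
      using B(2) by (metis Krein_Milman_Minkowski convex_convex_hull finite_imp_compact_convex_hull)
    have "\<exists>a b. a extreme_point_of D \<and> b extreme_point_of D \<and> a \<noteq> b"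
    proof (rule ccontr)
      assume "\<not> ?thesis"
      then have "{v. v extreme_point_of D} = {} \<or> (\<exists>a. {v. v extreme_point_of D} = {a})"
        by blast
      then have "D = {} \<or> (\<exists>a. D = {a})" using KM by (elim disjE exE) (simp_all only: convex_hull_empty convex_hull_singleton, auto)
      then show False using D(2) by auto
    qed
    then obtain a b where ab: "a extreme_point_of D" "b extreme_point_of D" "a \<noteq> b" by blast
    have top: "trop_term lam v x = trop_eval A lam x" if "v extreme_point_of D" for v
    proof (rule antisym)
      have "\<forall>b\<in>A. trop_term lam b x \<le> trop_term lam v x"
        using D(3) that unfolding dual_cell_def by blast
      then show "trop_eval A lam x \<le> trop_term lam v x"
        using fin ne by (simp add: trop_eval_def)
    qed (use ext le_eval that in blast)
    show "x \<in> V_tr A lam"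
      unfolding V_tr_def using ab ext top by blast
  next
    fix x assume "x \<in> V_tr A lam"
    then obtain a b where ab: "a \<in> A" "b \<in> A" "a \<noteq> b"
      "trop_term lam a x = trop_eval A lam x" "trop_term lam b x = trop_eval A lam x"
      by (auto simp: V_tr_def)
    define P where "P = lifted_polytope A lam"
    define r where "r = trop_eval A lam x"
    define F where "F = P \<inter> {z. (x, 1) \<bullet> z = r}"
    have term_eq: "(x, 1) \<bullet> (c, lam c) = trop_term lam c x" for c
      by (simp add: trop_term_def inner_commute)
    have sub: "P \<subseteq> {z. (x, 1) \<bullet> z \<le> r}"
      unfolding P_def lifted_polytope_def
    proof (rule hull_minimal)
      show "(\<lambda>a. (a, lam a)) ` A \<subseteq> {z. (x, 1) \<bullet> z \<le> r}"
        using le_eval term_eq r_def by fastforce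
    qed (rule convex_halfspace_le)
    have inF: "(c, lam c) \<in> F" if "c \<in> A" "trop_term lam c x = r" for c
      using that term_eq[of c] by (auto simp: F_def P_def lifted_polytope_def hull_inc)
    have "convex P" by (simp add: P_def lifted_polytope_def)
    then have "F face_of P"
      unfolding F_def using sub by (intro face_of_Int_supporting_hyperplane_le) auto
    then have up: "F upper_face_of P"
      unfolding upper_face_of_def using sub inF[of a] ab(1,4) \<open>F face_of P\<close> F_def r_def
      by (intro conjI exI[of _ x] exI[of _ "1::real"] exI[of _ r]) auto
    define D where "D = fst ` F"
    have DS: "D \<in> Subdiv A lam" using up by (auto simp: D_def P_def Subdiv_def)
    have abD: "a \<in> D" "b \<in> D"
      using inF[of a] inF[of b] ab r_def by (force simp: D_def)+
    have "aff_dim D \<ge> 1"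
    proof -
      have "aff_dim {a, b} \<le> aff_dim D" using abD by (intro aff_dim_subset) auto
      then show ?thesis using ab(3) by (simp add: aff_dim_2)
    qed
    moreover have "x \<in> dual_cell A lam D"
    proof -
      have "trop_term lam v x = r" if "v extreme_point_of D" for v
      proof -
        have comp: "compact ((\<lambda>a. (a, lam a)) ` A)" using fin by (simp add: finite_imp_compact)
        obtain S where S: "S \<subseteq> (\<lambda>a. (a, lam a)) ` A" "F = convex hull S"
          by (rule face_of_convex_hull_subset[OF comp
                \<open>F face_of P\<close>[unfolded P_def lifted_polytope_def]])
        have "D = convex hull (fst ` S)"
          using S(2) convex_hull_linear_image[OF linear_fst, of S] by (simp add: D_def)
        then have "v \<in> fst ` S" using that extreme_point_of_convex_hull by blast
        then have "(v, lam v) \<in> S" using S(1) by auto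
        then have "(v, lam v) \<in> F" using S(2) hull_inc by metis
        then show ?thesis using term_eq[of v] by (simp add: F_def)
      qed
      then show ?thesis using le_eval by (auto simp: dual_cell_def r_def)
    qed
    ultimately show "x \<in> \<Union>(tropical_cells A lam)"
      using DS by (auto simp: tropical_cells_def)
  qed
qed

end

theory Submission
  imports Defs
begin

text \<open>
  Let \<open>c = (1/2, 1/2, 1/2)\<close>. In a unimodular tetrahedron of the subdivision containing \<open>c\<close>, the
  barycentric coordinates of \<open>c\<close> lie in \<open>\<int>/2\<close>, so \<open>c\<close> is the midpoint of an edge \<open>[p, q]\<close>. Its dual cell
  is \<open>{x. \<forall>a\<in>A. lam a + a \<bullet> x \<le> l + c \<bullet> x}\<close> with \<open>l = (lam p + lam q) / 2\<close>, which is bounded because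
  \<open>c\<close> is interior to the Newton polytope. Conversely, a 2-cell is dual to an edge \<open>[a, b]\<close>, and if it
  is bounded then no facet contains both ends. With \<open>a\<^sub>0 = 2 - a\<^sub>1 - a\<^sub>2 - a\<^sub>3\<close>, this says
  \<open>a\<^sub>i + b\<^sub>i \<ge> 1\<close> for \<open>i = 0, \<dots>, 3\<close>, while these four sums add up to \<open>4\<close>; so \<open>c\<close> is the midpoint of
  \<open>[a, b]\<close> too. Both \<open>l\<close> and the cell are determined by the midpoint, so the two cells agree.
\<close>

section \<open>Cells of the subdivision as hulls of the exponents dominant at a point\<close>

definition active :: "(real^3) set \<Rightarrow> (real^3 \<Rightarrow> real) \<Rightarrow> real^3 \<Rightarrow> (real^3) set" where
  "active A lam x = {a\<in>A. trop_term lam a x = trop_eval A lam x}"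

lemma trop_term_le_eval: "finite A \<Longrightarrow> a \<in> A \<Longrightarrow> trop_term lam a x \<le> trop_eval A lam x"
  by (simp add: trop_eval_def)

lemma trop_eval_eqI:
  assumes "finite A" "a \<in> A" "trop_term lam a x = r" "\<And>b. b \<in> A \<Longrightarrow> trop_term lam b x \<le> r"
  shows "trop_eval A lam x = r"
  unfolding trop_eval_def using assms by (intro Max_eqI) auto

lemma active_nonempty: "finite A \<Longrightarrow> A \<noteq> {} \<Longrightarrow> active A lam x \<noteq> {}"
  unfolding active_def trop_eval_def
  using Max_in[of "(\<lambda>a. trop_term lam a x) ` A"] by fastforce

text \<open>Some subset of \<open>S\<close> spans the face \<open>F\<close>; it lies in
  \<open>S \<inter> F\<close>, whose hull in turn lies in the convex set \<open>F\<close>.\<close>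

lemma convex_hull_face_eq:
  fixes S :: "'a::euclidean_space set"
  assumes "finite S" "F face_of convex hull S"
  shows "F = convex hull (S \<inter> F)"
proof -
  obtain T where "T \<subseteq> S" "F = convex hull T"
    using face_of_convex_hull_subset[of S F] finite_imp_compact[OF assms(1)] assms(2) by blast
  then have "T \<subseteq> S \<inter> F" by (simp add: hull_subset)
  then show ?thesis
    using \<open>F = convex hull T\<close> face_of_imp_convex[OF assms(2)]
    by (metis Int_lower2 hull_minimal hull_mono subset_antisym)
qed

lemma lifted_face_projection:
  assumes fin: "finite A" and F: "F face_of lifted_polytope A lam"
  shows "fst ` F = convex hull {a\<in>A. (a, lam a) \<in> F}"
proof -
  let ?L = "(\<lambda>a. (a, lam a)) ` A"
  have "F = convex hull (?L \<inter> F)"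
    using convex_hull_face_eq fin F unfolding lifted_polytope_def by blast
  then have "fst ` F = convex hull (fst ` (?L \<inter> F))"
    using convex_hull_linear_image[OF linear_fst] by metis
  also have "fst ` (?L \<inter> F) = {a\<in>A. (a, lam a) \<in> F}" by force
  finally show ?thesis .
qed

text \<open>Rescaling an outer normal \<open>(u, s)\<close> with \<open>s > 0\<close> to
  \<open>(x, 1)\<close> turns its value at \<open>(a, lam a)\<close> into the term of
  \<open>a\<close> at \<open>x\<close>. Upper faces of the lifted polytope thus correspond to the
  sets of terms that are maximal at some \<open>x\<close>.\<close>

lemma Subdiv_iff:
  assumes fin: "finite A" and ne: "A \<noteq> {}"
  shows "D \<in> Subdiv A lam \<longleftrightarrow> (\<exists>x. D = convex hull (active A lam x))"
proof
  assume "D \<in> Subdiv A lam"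
  then obtain F u s r where D: "D = fst ` F" and face: "F face_of lifted_polytope A lam"
    and "F \<noteq> {}" and s: "s > 0" and sub: "lifted_polytope A lam \<subseteq> {z. (u, s) \<bullet> z \<le> r}"
    and F: "F = lifted_polytope A lam \<inter> {z. (u, s) \<bullet> z = r}"
    unfolding Subdiv_def upper_face_of_def by blast
  have mem: "(a, lam a) \<in> lifted_polytope A lam" if "a \<in> A" for a
    using that by (simp add: lifted_polytope_def hull_inc)
  define x where "x = (1 / s) *\<^sub>R u"
  have tt: "trop_term lam a x = ((u, s) \<bullet> (a, lam a)) / s" for a
    using s by (simp add: trop_term_def x_def inner_commute field_simps)
  have le: "trop_term lam a x \<le> r / s" if "a \<in> A" for a
    using sub mem[OF that] s tt by (simp add: divide_right_mono subset_iff)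
  have eq: "trop_term lam a x = r / s \<longleftrightarrow> (a, lam a) \<in> F" if "a \<in> A" for a
    using mem[OF that] s tt F by auto
  have hull: "D = convex hull {a\<in>A. (a, lam a) \<in> F}"
    using lifted_face_projection[OF fin face] D by simp
  \<comment> \<open>An exponent attaining \<open>r / s\<close> is required, since otherwise
    \<open>r / s\<close> would only be an upper bound of \<open>trop_eval A lam x\<close>.\<close>
  have "{a\<in>A. (a, lam a) \<in> F} \<noteq> {}"
  proof
    assume "{a\<in>A. (a, lam a) \<in> F} = {}"
    then have "fst ` F = {}" using hull D by (simp only: convex_hull_empty)
    then show False using \<open>F \<noteq> {}\<close> by simp
  qed
  then obtain a where "a \<in> A" "(a, lam a) \<in> F" by blast
  then have "trop_eval A lam x = r / s"
    using eq le by (intro trop_eval_eqI[OF fin]) auto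
  then have "active A lam x = {a\<in>A. (a, lam a) \<in> F}"
    using eq by (auto simp: active_def)
  then show "\<exists>x. D = convex hull (active A lam x)" using hull by (intro exI[of _ x]) simp
next
  assume "\<exists>x. D = convex hull (active A lam x)"
  then obtain x where D: "D = convex hull (active A lam x)" ..
  define r where "r = trop_eval A lam x"
  define F where "F = lifted_polytope A lam \<inter> {z. (x, 1) \<bullet> z = r}"
  have tt: "(x, 1) \<bullet> (a, lam a) = trop_term lam a x" for a
    by (simp add: trop_term_def inner_commute)
  have sub: "lifted_polytope A lam \<subseteq> {z. (x, 1) \<bullet> z \<le> r}"
    unfolding lifted_polytope_def
  proof (rule hull_minimal)
    show "(\<lambda>a. (a, lam a)) ` A \<subseteq> {z. (x, 1) \<bullet> z \<le> r}"
      using trop_term_le_eval[OF fin] tt r_def by auto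
  qed (rule convex_halfspace_le)
  have face: "F face_of lifted_polytope A lam"
    unfolding F_def using sub
    by (intro face_of_Int_supporting_hyperplane_le) (auto simp: lifted_polytope_def)
  have "(a, lam a) \<in> lifted_polytope A lam" if "a \<in> A" for a
    using that by (simp add: lifted_polytope_def hull_inc)
  then have act: "{a\<in>A. (a, lam a) \<in> F} = active A lam x"
    using tt by (auto simp: F_def active_def r_def)
  then have "F \<noteq> {}" using active_nonempty[OF fin ne] by blast
  then have "F upper_face_of lifted_polytope A lam"
    unfolding upper_face_of_def using sub face F_def
    by (intro conjI exI[of _ x] exI[of _ "1::real"] exI[of _ r]) auto
  moreover have "D = fst ` F" using lifted_face_projection[OF fin face] act D by simp
  ultimately show "D \<in> Subdiv A lam" unfolding Subdiv_def by blast
qed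

text \<open>Finiteness guarantees that every cell of the subdivision lies in a maximal one.\<close>

lemma finite_Subdiv:
  assumes "finite A"
  shows "finite (Subdiv A lam)"
proof (rule finite_subset)
  show "Subdiv A lam \<subseteq> (\<lambda>B. convex hull B) ` Pow A"
    using Subdiv_hull[OF assms] by (metis (no_types, lifting) PowI image_eqI subsetI)
qed (use assms in simp)

text \<open>Moving \<open>x\<close> slightly along a normal of the face \<open>T\<close> leaves only the terms in \<open>T\<close> maximal.\<close>

lemma face_of_Subdiv:
  assumes fin: "finite A" and ne: "A \<noteq> {}"
    and D: "D \<in> Subdiv A lam" and T: "T face_of D" "T \<noteq> {}"
  shows "T \<in> Subdiv A lam"
proof -
  obtain x where x: "D = convex hull (active A lam x)" using D Subdiv_iff[OF fin ne] by blast
  have fina: "finite (active A lam x)" using fin by (simp add: active_def)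
  \<comment> \<open>The exposing normal \<open>u\<close> is the direction in which \<open>x\<close>
    gets moved.\<close>
  have "T exposed_face_of D"
    using T(1) x fina exposed_face_of_polyhedron polyhedron_convex_hull by metis
  then obtain u r where ur: "D \<subseteq> {y. u \<bullet> y \<le> r}" "T = D \<inter> {y. u \<bullet> y = r}"
    unfolding exposed_face_of_def by blast
  define m where "m = trop_eval A lam x"
  \<comment> \<open>The finitely many terms strictly below the maximum at \<open>x\<close> stay
    below for small \<open>e\<close>. The shift by \<open>r\<close> compares them with
    \<open>m + e * r\<close>, the new maximum.\<close>
  have "\<forall>\<^sub>F e in at_right 0. \<forall>a\<in>A - active A lam x. trop_term lam a x + e * (u \<bullet> a - r) < m"
  proof (intro eventually_ball_finite ballI)
    fix a assume a: "a \<in> A - active A lam x"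
    then have "trop_term lam a x < m"
      using trop_term_le_eval[OF fin, of a lam x] by (auto simp: active_def m_def)
    moreover have "((\<lambda>e. trop_term lam a x + e * (u \<bullet> a - r)) \<longlongrightarrow>
        trop_term lam a x + 0 * (u \<bullet> a - r)) (at_right 0)"
      by (intro tendsto_intros)
    ultimately show "\<forall>\<^sub>F e in at_right 0. trop_term lam a x + e * (u \<bullet> a - r) < m"
      by (simp add: order_tendstoD(2))
  qed (use fin in auto)
  then have "\<forall>\<^sub>F e in at_right 0. 0 < e \<and>
      (\<forall>a\<in>A - active A lam x. trop_term lam a x + e * (u \<bullet> a - r) < m)"
    by (rule eventually_conj[OF eventually_at_right_less])
  then obtain e where e: "e > 0"
    "\<And>a. a \<in> A - active A lam x \<Longrightarrow> trop_term lam a x + e * (u \<bullet> a - r) < m"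
    using eventually_happens[of _ "at_right (0::real)"] trivial_limit_at_right_real by blast
  define y where "y = x + e *\<^sub>R u"
  have ty: "trop_term lam a y = trop_term lam a x + e * (u \<bullet> a)" for a
    by (simp add: trop_term_def y_def inner_add_right inner_commute)
  have on: "trop_term lam a y \<le> m + e * r" "trop_term lam a y = m + e * r \<longleftrightarrow> a \<in> T"
    if "a \<in> active A lam x" for a
  proof -
    have "a \<in> D" using that x by (simp add: hull_inc)
    then show "trop_term lam a y \<le> m + e * r" "trop_term lam a y = m + e * r \<longleftrightarrow> a \<in> T"
      using that ty ur e(1) by (auto simp: active_def m_def)
  qed
  have off: "trop_term lam a y < m + e * r" if "a \<in> A - active A lam x" for a
    using e(2)[OF that] ty by (simp add: algebra_simps)
  have Th: "T = convex hull (active A lam x \<inter> T)"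
    using convex_hull_face_eq[OF fina] T(1) x by simp
  then have "active A lam x \<inter> T \<noteq> {}" using T(2) by (metis convex_hull_eq_empty)
  then obtain a where a: "a \<in> active A lam x" "a \<in> T" by blast
  have "trop_eval A lam y = m + e * r"
  proof (rule trop_eval_eqI[OF fin])
    show "a \<in> A" using a by (simp add: active_def)
    show "trop_term lam a y = m + e * r" using a on by blast
    show "trop_term lam b y \<le> m + e * r" if "b \<in> A" for b
      using on(1)[of b] off[of b] that by fastforce
  qed
  then have "active A lam y = active A lam x \<inter> T"
    using on(2) off unfolding active_def[of A lam y] by (force simp: active_def)
  then show ?thesis using Th Subdiv_iff[OF fin ne] by metis
qed

section \<open>Covering of the interior of the Newton polytope by the subdivision\<close>

lemma interior_linear_max_zero:
  fixes c :: "'a::real_inner"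
  assumes "c \<in> interior S" "\<And>y. y \<in> S \<Longrightarrow> u \<bullet> y \<le> u \<bullet> c"
  shows "u = 0"
proof (rule ccontr)
  assume u: "u \<noteq> 0"
  obtain e where e: "e > 0" "cball c e \<subseteq> S" using assms(1) mem_interior_cball by metis
  have "c + (e / norm u) *\<^sub>R u \<in> S" using e u by (intro subsetD[OF e(2)]) (simp add: dist_norm)
  then have "(e / norm u) * (u \<bullet> u) \<le> 0" using assms(2) by (fastforce simp: inner_add_right)
  then have "u \<bullet> u \<le> 0" using e u by (auto simp: mult_le_0_iff divide_le_0_iff)
  then show False using u inner_gt_zero_iff[of u] by linarith
qed

text \<open>A hyperplane separating the lifted polytope from the vertical ray above its highest
  point \<open>(c, h)\<close> over \<open>c\<close> supports the polytope at \<open>(c, h)\<close>.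
  It is not vertical because \<open>c\<close> is interior, so it cuts out an upper face whose
  projection contains \<open>c\<close>.\<close>

lemma Subdiv_covers_interior:
  assumes fin: "finite A" and c: "c \<in> interior (convex hull A)"
  obtains D where "D \<in> Subdiv A lam" "c \<in> D"
proof -
  define P where "P = lifted_polytope A lam"
  have cvx: "convex P" and cmp: "compact P"
    using fin by (simp_all add: P_def lifted_polytope_def finite_imp_compact_convex_hull)
  have fstP: "fst ` P = convex hull A"
    using convex_hull_linear_image[OF linear_fst, of "(\<lambda>a. (a, lam a)) ` A"]
    by (simp add: P_def lifted_polytope_def image_image)
  define Z where "Z = P \<inter> {z. fst z = c}"
  have "c \<in> fst ` P" using c fstP interior_subset by blast
  then have "Z \<noteq> {}" by (auto simp: Z_def)
  moreover have "compact Z"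
  proof -
    have "closed {z :: (real^3) \<times> real. fst z = c}"
      by (intro closed_Collect_eq continuous_intros)
    then show ?thesis unfolding Z_def using cmp by (simp add: compact_Int_closed)
  qed
  ultimately obtain z where z: "z \<in> Z" "\<And>w. w \<in> Z \<Longrightarrow> snd w \<le> snd z"
    using continuous_attains_sup[of Z snd] continuous_on_snd[OF continuous_on_id] by blast
  define h where "h = snd z"
  have zP: "(c, h) \<in> P" using z(1) by (auto simp: Z_def h_def)
  have top: "t \<le> h" if "(c, t) \<in> P" for t using z(2)[of "(c, t)"] that by (simp add: Z_def h_def)
  \<comment> \<open>The end point \<open>(c, h)\<close> is left out, which makes the ray disjoint
    from \<open>P\<close>.\<close>
  define R where "R = {c} \<times> {h<..}"
  have "convex R" unfolding R_def by (intro convex_Times) auto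
  moreover have "R \<noteq> {}" by (auto simp: R_def intro: gt_ex)
  moreover have "P \<inter> R = {}" using top by (fastforce simp: R_def)
  ultimately obtain w r where w: "w \<noteq> 0" "\<forall>z\<in>P. w \<bullet> z \<le> r" "\<forall>z\<in>R. r \<le> w \<bullet> z"
    using separating_hyperplane_sets[OF cvx, of R] zP by blast
  obtain u s where us: "w = (u, s)" by (cases w)
  have ray: "r \<le> u \<bullet> c + s * t" if "t > h" for t
    using w(3) that by (auto simp: R_def us)
  have le: "u \<bullet> c + s * h \<le> r" using w(2) zP by (auto simp: us)
  have s0: "s \<ge> 0" using ray[of "h + 1"] le by (simp add: algebra_simps)
  \<comment> \<open>For \<open>s = 0\<close> the functional \<open>u\<close> would be maximal over
    the Newton polytope at the interior point \<open>c\<close>, so \<open>u\<close> and hence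
    \<open>w\<close> would vanish.\<close>
  have s: "s > 0"
  proof (rule ccontr)
    assume "\<not> s > 0"
    then have [simp]: "s = 0" using s0 by simp
    have "u \<bullet> y \<le> u \<bullet> c" if y: "y \<in> convex hull A" for y
    proof -
      obtain t where "(y, t) \<in> P" using y fstP by force
      then have "u \<bullet> y \<le> r" using w(2) by (force simp: us)
      then show ?thesis using ray[of "h + 1"] by simp
    qed
    then have "u = 0" using interior_linear_max_zero[OF c] by blast
    then show False using w(1) us by (simp add: zero_prod_def)
  qed
  \<comment> \<open>The ray omits height \<open>h\<close>, so the bound there is the limit of the
    bounds at heights \<open>h + e / s\<close>.\<close>
  have "r \<le> u \<bullet> c + s * h"
  proof (rule field_le_epsilon)
    fix e :: real assume "e > 0"
    then show "r \<le> u \<bullet> c + s * h + e" using ray[of "h + e / s"] s by (simp add: distrib_left)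
  qed
  then have eq: "(u, s) \<bullet> (c, h) = r" using le by simp
  define F where "F = P \<inter> {z. (u, s) \<bullet> z = r}"
  have sub: "P \<subseteq> {z. (u, s) \<bullet> z \<le> r}" using w(2) us by blast
  have inF: "(c, h) \<in> F" using zP eq by (simp add: F_def)
  have "F face_of P"
    unfolding F_def using sub cvx by (intro face_of_Int_supporting_hyperplane_le) auto
  then have "F upper_face_of P"
    unfolding upper_face_of_def using sub s inF F_def
    by (intro conjI exI[of _ u] exI[of _ s] exI[of _ r]) auto
  then have "fst ` F \<in> Subdiv A lam" by (auto simp: Subdiv_def P_def)
  moreover have "c \<in> fst ` F" using inF by force
  ultimately show thesis using that by blast
qed

section \<open>Dual cells of segments: compactness, dependence on the midpoint, dimension\<close>

text \<open>The inequalities at the exponents extend to their convex hull, as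
  \<open>x \<bullet> y \<le> K + x \<bullet> c\<close>. Testing this at the point of a ball around
  \<open>c\<close> that lies at distance \<open>e\<close> in the direction of \<open>x\<close> gives
  \<open>e * norm x \<le> K\<close>.\<close>

lemma compact_dominating_region:
  assumes fin: "finite A" and c: "c \<in> interior (convex hull A)"
  shows "compact {x. \<forall>a\<in>A. trop_term lam a x \<le> l + c \<bullet> x}" (is "compact ?C")
proof -
  obtain e where e: "e > 0" "cball c e \<subseteq> convex hull A" using c mem_interior_cball by metis
  define K where "K = Max ((\<lambda>a. l - lam a) ` A)"
  have K: "l - lam a \<le> K" if "a \<in> A" for a using fin that by (simp add: K_def)
  have "norm x \<le> K / e" if x: "x \<in> ?C" for x
  proof (cases "x = 0")
    case True
    have "c \<in> convex hull A" using c interior_subset by blast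
    then obtain a where "a \<in> A" by fastforce
    then have "0 \<le> K" using K[of a] x True by (force simp: trop_term_def)
    then show ?thesis using e True by simp
  next
    case False
    have "convex hull A \<subseteq> {y. x \<bullet> y \<le> K + x \<bullet> c}"
    proof (rule hull_minimal)
      show "A \<subseteq> {y. x \<bullet> y \<le> K + x \<bullet> c}"
      proof
        fix a assume a: "a \<in> A"
        then have "lam a + a \<bullet> x \<le> l + c \<bullet> x" using x by (simp add: trop_term_def)
        then show "a \<in> {y. x \<bullet> y \<le> K + x \<bullet> c}" using K[OF a] by (simp add: inner_commute)
      qed
    qed (rule convex_halfspace_le)
    moreover have "c + (e / norm x) *\<^sub>R x \<in> cball c e" using e False by (simp add: dist_norm)
    ultimately have "x \<bullet> (c + (e / norm x) *\<^sub>R x) \<le> K + x \<bullet> c" using e(2) by blast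
    then have "(e / norm x) * (norm x * norm x) \<le> K"
      by (simp add: inner_add_right dot_square_norm power2_eq_square)
    then show ?thesis using e False by (simp add: field_simps)
  qed
  then have "bounded ?C" by (auto simp: bounded_iff)
  moreover have "closed ?C"
  proof -
    have "?C = (\<Inter>a\<in>A. {x. trop_term lam a x \<le> l + c \<bullet> x})" by auto
    then show ?thesis unfolding trop_term_def
      by (auto intro!: closed_INT closed_Collect_le continuous_intros)
  qed
  ultimately show ?thesis by (simp add: compact_eq_bounded_closed)
qed

lemma dual_cell_segment:
  "dual_cell A lam (closed_segment a b) =
     {x. trop_term lam a x = trop_term lam b x \<and> (\<forall>d\<in>A. trop_term lam d x \<le> trop_term lam a x)}"
  unfolding dual_cell_def by (auto simp: extreme_point_of_segment)

text \<open>Both ends lie in \<open>A\<close>, so if the average of the two end terms dominates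
  every term, it dominates these two as well and they must be equal. The cell is thus expressed
  through the midpoint and the sum of the two coefficients alone.\<close>

lemma dual_cell_segment_midpoint:
  assumes "a \<in> A" "b \<in> A"
  shows "dual_cell A lam (closed_segment a b) =
     {x. \<forall>d\<in>A. trop_term lam d x \<le> (lam a + lam b) / 2 + midpoint a b \<bullet> x}"
proof -
  have "(lam a + lam b) / 2 + midpoint a b \<bullet> x = (trop_term lam a x + trop_term lam b x) / 2" for x
    by (simp add: trop_term_def midpoint_def inner_add_left field_simps)
  moreover have "u = v \<and> (\<forall>d\<in>A. trop_term lam d x \<le> u) \<longleftrightarrow>
      (\<forall>d\<in>A. trop_term lam d x \<le> (u + v) / 2)"
    if "u = trop_term lam a x" "v = trop_term lam b x" for u v x
  proof
    assume r: "\<forall>d\<in>A. trop_term lam d x \<le> (u + v) / 2"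
    then have "u \<le> (u + v) / 2" "v \<le> (u + v) / 2" using assms that by auto
    then have "u = v" by simp
    with r show "u = v \<and> (\<forall>d\<in>A. trop_term lam d x \<le> u)" by simp
  qed auto
  ultimately show ?thesis unfolding dual_cell_segment by (simp only:)
qed

text \<open>At a point of the first cell, adding the inequalities for \<open>p\<close> and
  \<open>q\<close> cancels the common midpoint and leaves
  \<open>lam p + lam q \<le> lam a + lam b\<close>. By symmetry the two sums agree.\<close>

lemma dual_cell_segment_eqI:
  assumes ab: "a \<in> A" "b \<in> A" and pq: "p \<in> A" "q \<in> A" and mid: "midpoint a b = midpoint p q"
    and ne: "dual_cell A lam (closed_segment a b) \<noteq> {}" "dual_cell A lam (closed_segment p q) \<noteq> {}"
  shows "dual_cell A lam (closed_segment a b) = dual_cell A lam (closed_segment p q)"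
proof -
  have le: "lam r + lam s \<le> lam a + lam b"
    if ab: "a \<in> A" "b \<in> A" and rs: "r \<in> A" "s \<in> A" and mid: "midpoint a b = midpoint r s"
      and ne: "dual_cell A lam (closed_segment a b) \<noteq> {}" for a b r s
  proof -
    obtain x where "\<forall>d\<in>A. trop_term lam d x \<le> (lam a + lam b) / 2 + midpoint a b \<bullet> x"
      using ne unfolding dual_cell_segment_midpoint[OF ab] by blast
    then have "trop_term lam r x \<le> (lam a + lam b) / 2 + midpoint r s \<bullet> x"
      "trop_term lam s x \<le> (lam a + lam b) / 2 + midpoint r s \<bullet> x"
      using rs mid by simp_all
    then show ?thesis by (simp add: trop_term_def midpoint_def inner_add_left field_simps)
  qed
  have "lam a + lam b = lam p + lam q"
    using le[of a b p q] le[of p q a b] assms by auto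
  then show ?thesis
    by (simp only: dual_cell_segment_midpoint[OF ab] dual_cell_segment_midpoint[OF pq] mid)
qed

text \<open>The terms at all extreme points of \<open>D\<close> agree on the dual cell, so
  differences of points of the cell are orthogonal to differences of extreme points, and the latter
  span the directions of \<open>D\<close>.\<close>

lemma aff_dim_dual_cell_le:
  assumes D: "compact D" "convex D" "D \<noteq> {}" and ne: "dual_cell A lam D \<noteq> {}"
  shows "aff_dim (dual_cell A lam D) + aff_dim D \<le> 3"
proof -
  define E where "E = {v. v extreme_point_of D}"
  have DE: "D = convex hull E" using Krein_Milman_Minkowski[OF D(1,2)] by (simp add: E_def)
  then obtain e where e: "e \<in> E" using D(3) by fastforce
  obtain x where x: "x \<in> dual_cell A lam D" using ne by blast
  have orth: "v \<bullet> w = 0"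
    if vw: "v \<in> (+) (- x) ` dual_cell A lam D" "w \<in> (+) (- e) ` E" for v w
  proof -
    obtain y d where yd: "v = y - x" "y \<in> dual_cell A lam D" "w = d - e" "d \<in> E" using vw by auto
    have "trop_term lam d y = trop_term lam e y" "trop_term lam d x = trop_term lam e x"
      using yd x e unfolding dual_cell_def E_def by blast+
    then show ?thesis
      by (simp add: yd trop_term_def inner_diff_left inner_diff_right inner_commute)
  qed
  have "dim ((+) (- x) ` dual_cell A lam D) + dim ((+) (- e) ` E) \<le> DIM(real^3)"
    using dim_orthogonal_sum[OF orth] dim_subset_UNIV by metis
  moreover have "aff_dim (dual_cell A lam D) = dim ((+) (- x) ` dual_cell A lam D)"
    using x by (intro aff_dim_eq_dim) (simp add: hull_inc)
  moreover have "aff_dim D = dim ((+) (- e) ` E)"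
    using e aff_dim_eq_dim[of e E] by (simp add: DE hull_inc aff_dim_convex_hull del: uminus_add_conv_diff)
  ultimately show ?thesis by simp
qed

text \<open>The cell lies in the plane \<open>H\<close> where the terms of \<open>a\<close> and
  \<open>b\<close> agree. Near \<open>x\<close> it fills that plane, because all other terms are
  strictly smaller on the open set \<open>U\<close>.\<close>

lemma aff_dim_dual_cell_segment:
  assumes fin: "finite A" and ab: "a \<noteq> b" and x: "active A lam x = {a, b}"
  shows "aff_dim (dual_cell A lam (closed_segment a b)) = 2"
proof -
  define m where "m = trop_eval A lam x"
  define H where "H = {y. (a - b) \<bullet> y = lam b - lam a}"
  define U where "U = (\<Inter>d\<in>A - {a, b}. {y. trop_term lam d y < trop_term lam a y})"
  have mem: "d \<in> A \<and> trop_term lam d x = m \<longleftrightarrow> d \<in> {a, b}" for d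
    unfolding x[symmetric] by (simp add: active_def m_def)
  then have inA: "a \<in> A" "b \<in> A" and m: "trop_term lam a x = m" "trop_term lam b x = m"
    by blast+
  have "trop_term lam d x < trop_term lam a x" if "d \<in> A - {a, b}" for d
    using that mem[of d] trop_term_le_eval[OF fin, of d lam x] m(1) unfolding m_def[symmetric]
    by (metis DiffE order_le_imp_less_or_eq)
  then have xU: "x \<in> U" unfolding U_def by blast
  have H: "y \<in> H \<longleftrightarrow> trop_term lam a y = trop_term lam b y" for y
    unfolding H_def trop_term_def mem_Collect_eq inner_diff_left by linarith
  have "open U"
    unfolding U_def trop_term_def using fin
    by (intro open_INT ballI open_Collect_less continuous_intros) auto
  moreover have "x \<in> H" using H m by simp
  moreover have "convex H" unfolding H_def by (rule convex_hyperplane)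
  ultimately have "aff_dim (H \<inter> U) = aff_dim H"
    using xU by (intro aff_dim_convex_Int_open) auto
  also have "aff_dim H = 2" using ab by (simp add: H_def aff_dim_hyperplane)
  finally have HU: "aff_dim (H \<inter> U) = 2" .
  have "H \<inter> U \<subseteq> dual_cell A lam (closed_segment a b)"
  proof
    fix y assume y: "y \<in> H \<inter> U"
    then have "trop_term lam d y \<le> trop_term lam a y" if "d \<in> A" for d
      using H that by (cases "d \<in> {a, b}") (auto simp: U_def intro: less_imp_le)
    then show "y \<in> dual_cell A lam (closed_segment a b)"
      using y H by (auto simp: dual_cell_segment)
  qed
  then have ge: "aff_dim (dual_cell A lam (closed_segment a b)) \<ge> 2"
    using aff_dim_subset HU by metis
  have "aff_dim (dual_cell A lam (closed_segment a b)) \<le> aff_dim H"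
    by (intro aff_dim_subset) (auto simp: dual_cell_segment H)
  with ge \<open>aff_dim H = 2\<close> show ?thesis by simp
qed

text \<open>The cell dual to a segment in the face with outer normal \<open>n\<close> recedes in direction \<open>n\<close>.\<close>

lemma dual_cell_segment_bounded_imp:
  assumes bdd: "bounded (dual_cell A lam (closed_segment a b))"
    and ne: "dual_cell A lam (closed_segment a b) \<noteq> {}"
    and n: "n \<bullet> a = n \<bullet> b" "\<And>d. d \<in> A \<Longrightarrow> n \<bullet> d \<le> n \<bullet> a"
  shows "n = 0"
proof (rule ccontr)
  assume n0: "n \<noteq> 0"
  obtain x where x: "x \<in> dual_cell A lam (closed_segment a b)" using ne by blast
  obtain K where K: "\<And>y. y \<in> dual_cell A lam (closed_segment a b) \<Longrightarrow> norm y \<le> K"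
    using bdd by (auto simp: bounded_iff)
  \<comment> \<open>Large enough to leave the ball of radius \<open>K\<close> even after the
    triangle inequality costs \<open>norm x\<close>.\<close>
  define t where "t = (\<bar>K\<bar> + norm x + 1) / norm n"
  have "t \<ge> 0" unfolding t_def by simp
  have tt: "trop_term lam d (x + t *\<^sub>R n) = trop_term lam d x + t * (n \<bullet> d)" for d
    by (simp add: trop_term_def inner_add_right inner_commute)
  have "x + t *\<^sub>R n \<in> dual_cell A lam (closed_segment a b)"
    using x n \<open>t \<ge> 0\<close> by (auto simp: dual_cell_segment tt add_mono mult_left_mono)
  then have "norm (x + t *\<^sub>R n) \<le> K" by (rule K)
  moreover have "norm (t *\<^sub>R n) \<le> norm (x + t *\<^sub>R n) + norm x"
    by (metis add_diff_cancel_left' norm_triangle_ineq4 add.commute)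
  moreover have "norm (t *\<^sub>R n) = \<bar>K\<bar> + norm x + 1"
    using n0 by (simp add: t_def)
  ultimately show False by linarith
qed

section \<open>The simplex of degree \<open>d\<close> in coordinates\<close>

lemma Basis_vec3: "(Basis :: (real^3) set) = {axis 1 1, axis 2 1, axis 3 1}"
  by (auto simp: Basis_vec_def UNIV_3)

lemma Gamma_simplex_iff:
  assumes "d > 0"
  shows "x \<in> Gamma_simplex d \<longleftrightarrow> (\<forall>i. 0 \<le> x $ i) \<and> x $ 1 + x $ 2 + x $ 3 \<le> real d"
proof -
  have ax: "vector [0, 0, 0] = (0 :: real^3)" "vector [real d, 0, 0] = real d *\<^sub>R (axis 1 1 :: real^3)"
    "vector [0, real d, 0] = real d *\<^sub>R (axis 2 1 :: real^3)"
    "vector [0, 0, real d] = real d *\<^sub>R (axis 3 1 :: real^3)"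
    by (simp_all add: vec_eq_iff forall_3 axis_def)
  have "Gamma_simplex d = convex hull ((*\<^sub>R) (real d) ` insert 0 (Basis :: (real^3) set))"
    unfolding Gamma_simplex_def ax Basis_vec3 by simp
  also have "\<dots> = (*\<^sub>R) (real d) ` (convex hull (insert 0 Basis))"
    by (rule convex_hull_scaling)
  also have "\<dots> = (*\<^sub>R) (real d) ` {x. (\<forall>i\<in>Basis. 0 \<le> x \<bullet> i) \<and> sum ((\<bullet>) x) Basis \<le> 1}"
    by (simp only: std_simplex)
  also have "\<dots> = (*\<^sub>R) (real d) ` {x. (\<forall>i. 0 \<le> x $ i) \<and> x $ 1 + x $ 2 + x $ 3 \<le> 1}"
  proof -
    have "sum ((\<bullet>) y) Basis = y $ 1 + y $ 2 + y $ 3" for y :: "real^3"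
      by (simp add: Basis_vec3 axis_eq_axis inner_axis)
    moreover have "(\<forall>i\<in>Basis. 0 \<le> y \<bullet> i) \<longleftrightarrow> (\<forall>i. 0 \<le> y $ i)" for y :: "real^3"
      by (simp add: Basis_vec3 inner_axis forall_3)
    ultimately show ?thesis by simp
  qed
  finally have G: "Gamma_simplex d = \<dots>" .
  show ?thesis
  proof
    assume "x \<in> Gamma_simplex d"
    then obtain y where y: "x = real d *\<^sub>R y" "\<forall>i. 0 \<le> y $ i" "y $ 1 + y $ 2 + y $ 3 \<le> 1"
      unfolding G by blast
    then have "real d * (y $ 1 + y $ 2 + y $ 3) \<le> real d * 1" by (intro mult_left_mono) auto
    then show "(\<forall>i. 0 \<le> x $ i) \<and> x $ 1 + x $ 2 + x $ 3 \<le> real d" using y by (simp add: algebra_simps)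
  next
    assume r: "(\<forall>i. 0 \<le> x $ i) \<and> x $ 1 + x $ 2 + x $ 3 \<le> real d"
    have "x = real d *\<^sub>R ((1 / real d) *\<^sub>R x)" using assms by simp
    moreover have "(1 / real d) *\<^sub>R x \<in> {x. (\<forall>i. 0 \<le> x $ i) \<and> x $ 1 + x $ 2 + x $ 3 \<le> 1}"
      using r assms by (simp add: field_simps)
    ultimately show "x \<in> Gamma_simplex d" unfolding G by (rule image_eqI)
  qed
qed

lemma half_interior_Gamma: "vec (1/2) \<in> interior (Gamma_simplex 2)"
proof (rule interiorI)
  let ?U = "{x :: real^3. 0 < x $ 1} \<inter> {x. 0 < x $ 2} \<inter> {x. 0 < x $ 3} \<inter> {x. x $ 1 + x $ 2 + x $ 3 < 2}"
  show "open ?U" by (intro open_Int open_Collect_less continuous_intros)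
  show "vec (1/2) \<in> ?U" by simp
  show "?U \<subseteq> Gamma_simplex 2" by (auto simp: Gamma_simplex_iff forall_3)
qed

section \<open>Unimodular tetrahedra and half-integral points\<close>

lemma det_Ints:
  fixes M :: "real^'n^'n"
  assumes "\<And>i j. M $ i $ j \<in> \<int>"
  shows "det M \<in> \<int>"
  unfolding det_def using assms by (auto intro!: Ints_sum Ints_mult Ints_prod)

text \<open>Cramer's rule writes \<open>s $ k\<close> as an integral determinant divided by
  \<open>det M\<close>, which is 1 or -1.\<close>

lemma unimodular_solution_Ints:
  fixes M :: "real^'n^'n"
  assumes M: "\<And>i j. M $ i $ j \<in> \<int>" and det: "\<bar>det M\<bar> = 1" and s: "\<And>i. (M *v s) $ i \<in> \<int>"
  shows "s $ k \<in> \<int>"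
proof -
  let ?N = "\<chi> i j. if j = k then (M *v s) $ i else M $ i $ j"
  have "det M \<noteq> 0" using det by auto
  then have "s = (\<chi> k. det (\<chi> i j. if j = k then (M *v s) $ i else M $ i $ j) / det M)"
    using cramer by blast
  then have "s $ k = det ?N / det M" by (metis (no_types, lifting) vec_lambda_beta)
  moreover have "det ?N \<in> \<int>" using M s by (intro det_Ints) simp
  moreover have "det M = 1 \<or> det M = -1" using det by linarith
  ultimately show ?thesis by auto
qed

text \<open>Relative to a base vertex \<open>v0\<close>, the other three barycentric coordinates
  solve a linear system whose columns are the edge vectors at \<open>v0\<close>. Volume 1/6 makes
  its determinant 1 or -1, so \<open>N\<close> times the solution is integral.\<close>

lemma unimodular_barycentric_Ints:
  assumes D: "unimodular_tetrahedron D" and c: "c \<in> D" "\<And>i. real N * c $ i \<in> \<int>"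
  obtains C u where "\<not> affine_dependent C" "D = convex hull C" "\<And>v i. v \<in> C \<Longrightarrow> v $ i \<in> \<int>"
    "\<And>v. v \<in> C \<Longrightarrow> 0 \<le> u v" "\<And>v. v \<in> C \<Longrightarrow> real N * u v \<in> \<int>" "sum u C = 1" "(\<Sum>v\<in>C. u v *\<^sub>R v) = c"
proof -
  obtain C where C: "finite C" "\<not> affine_dependent C" "card C = 4" "D = convex hull C"
    using D unfolding unimodular_tetrahedron_def simplex by auto
  have int: "v $ i \<in> \<int>" if "v \<in> C" for v i
    using D that C extreme_point_of_convex_hull_affine_independent
    unfolding unimodular_tetrahedron_def by blast
  obtain u where u: "\<And>v. v \<in> C \<Longrightarrow> 0 \<le> u v" "sum u C = 1" "(\<Sum>v\<in>C. u v *\<^sub>R v) = c"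
    using c(1) C(1,4) by (auto simp: convex_hull_finite)
  have other: "real N * u v \<in> \<int>" if v0: "v0 \<in> C" and v: "v \<in> C - {v0}" for v0 v
  proof -
    have "card (C - {v0}) = CARD(3)" using C v0 by simp
    then obtain f :: "3 \<Rightarrow> real^3" where f: "bij_betw f UNIV (C - {v0})"
      using finite_same_card_bij[of "UNIV :: 3 set" "C - {v0}"] C(1) by auto
    define M :: "real^3^3" where "M = (\<chi> i. \<chi> j. f j $ i - v0 $ i)"
    have "measure lborel (convex hull C) = \<bar>det M\<bar> / fact (CARD(3))"
      unfolding M_def using C v0 f by (intro content_simplex) auto
    then have det: "\<bar>det M\<bar> = 1"
      using D C(4) by (simp add: unimodular_tetrahedron_def fact_numeral)
    have fC: "f j \<in> C" for j using f by (auto simp: bij_betw_def)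
    define s :: "real^3" where "s = (\<chi> j. real N * u (f j))"
    have Ms: "M *v s = real N *\<^sub>R (c - v0)"
    proof -
      have "c - v0 = (\<Sum>v\<in>C. u v *\<^sub>R v) - sum u C *\<^sub>R v0" using u by simp
      also have "\<dots> = (\<Sum>v\<in>C. u v *\<^sub>R (v - v0))"
        by (simp add: scaleR_diff_right sum_subtractf scaleR_left.sum)
      also have "\<dots> = (\<Sum>v\<in>C - {v0}. u v *\<^sub>R (v - v0))"
        using C(1) by (intro sum.mono_neutral_right) auto
      also have "\<dots> = (\<Sum>j\<in>UNIV. u (f j) *\<^sub>R (f j - v0))"
        using sum.reindex_bij_betw[OF f, of "\<lambda>v. u v *\<^sub>R (v - v0)"] by simp
      finally show ?thesis
        by (simp add: vec_eq_iff matrix_vector_mult_def M_def s_def sum_distrib_left mult_ac)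
    qed
    have Ms_int: "(M *v s) $ i \<in> \<int>" for i
      using c(2)[of i] int[OF v0] by (simp add: Ms right_diff_distrib)
    have M_int: "M $ i $ j \<in> \<int>" for i j
      using int[OF fC] int[OF v0] by (simp add: M_def)
    have "s $ j \<in> \<int>" for j
      by (rule unimodular_solution_Ints[OF M_int det Ms_int])
    moreover obtain j where "v = f j" using v f by (auto simp: bij_betw_def)
    ultimately show ?thesis by (metis s_def vec_lambda_beta)
  qed
  \<comment> \<open>Each vertex is covered by taking a different vertex \<open>w\<close> as the
    base.\<close>
  have "real N * u v \<in> \<int>" if v: "v \<in> C" for v
  proof -
    have "card (C - {v}) = 3" using C v by simp
    then have "C - {v} \<noteq> {}" by (metis card.empty zero_neq_numeral)
    then obtain w where "w \<in> C - {v}" by blast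
    then show ?thesis using other[of w v] v by auto
  qed
  then show thesis using that C int u by blast
qed

lemma sum_two_Ints_cases:
  fixes n :: "'a \<Rightarrow> real"
  assumes fin: "finite C" and n: "\<And>v. v \<in> C \<Longrightarrow> 0 \<le> n v" "\<And>v. v \<in> C \<Longrightarrow> n v \<in> \<int>" "sum n C = 2"
  obtains (one) p where "p \<in> C" "n p = 2" "\<And>v. v \<in> C - {p} \<Longrightarrow> n v = 0"
    | (two) p q where "p \<in> C" "q \<in> C" "p \<noteq> q" "n p = 1" "n q = 1" "\<And>v. v \<in> C - {p, q} \<Longrightarrow> n v = 0"
proof -
  have pos: "n v \<ge> 1" if "v \<in> C" "n v \<noteq> 0" for v
    using n(1,2)[OF that(1)] that(2) by (auto elim!: Ints_cases)
  have zero: "n v = 0" if "B \<subseteq> C" "sum n B = 0" "v \<in> B" for B v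
    using that sum_nonneg_eq_0_iff[of B n] n(1) fin finite_subset by (metis subsetD)
  obtain p where p: "p \<in> C" "n p \<noteq> 0" using n(3) sum.neutral by force
  have sp: "sum n (C - {p}) = 2 - n p" using n(3) p fin by (simp add: sum_diff1)
  show thesis
  proof (cases "n p = 2")
    case True
    then have "n v = 0" if "v \<in> C - {p}" for v
      using zero[of "C - {p}" v] that sp by auto
    then show thesis using one p(1) True by blast
  next
    case False
    have "sum n (C - {p}) \<ge> 0" using n(1) by (intro sum_nonneg) auto
    then have "n p = 1" using sp pos[OF p] False n(2)[OF p(1)] by (auto elim!: Ints_cases)
    then have s1: "sum n (C - {p}) = 1" using sp by simp
    then obtain q where q: "q \<in> C - {p}" "n q \<noteq> 0" using sum.neutral by force
    have sq: "sum n (C - {p} - {q}) = 1 - n q" using s1 q fin by (simp add: sum_diff1)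
    have "sum n (C - {p} - {q}) \<ge> 0" using n(1) by (intro sum_nonneg) auto
    then have nq: "n q = 1" using sq pos[of q] q by auto
    have "C - {p} - {q} = C - {p, q}" by auto
    then have "n v = 0" if "v \<in> C - {p, q}" for v
      using zero[of "C - {p, q}" v] that sq nq by auto
    then show thesis using two[of p q] p q \<open>n p = 1\<close> nq by auto
  qed
qed

text \<open>Twice the barycentric coordinates of \<open>c\<close> are nonnegative integers with sum
  2. The pattern 2 would make \<open>c\<close> a lattice vertex, against
  \<open>c $ k \<notin> \<int>\<close>; the pattern 1 + 1 makes it the midpoint of an edge.\<close>

lemma unimodular_half_lattice_point:
  assumes D: "unimodular_tetrahedron D" and c: "c \<in> D" "\<And>i. 2 * c $ i \<in> \<int>" "c $ k \<notin> \<int>"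
  obtains p q where "p extreme_point_of D" "q extreme_point_of D" "p \<noteq> q" "c = midpoint p q"
    "closed_segment p q face_of D"
proof -
  obtain C u where C: "\<not> affine_dependent C" "D = convex hull C" "\<And>v i. v \<in> C \<Longrightarrow> v $ i \<in> \<int>"
    and u: "\<And>v. v \<in> C \<Longrightarrow> 0 \<le> u v" "\<And>v. v \<in> C \<Longrightarrow> real 2 * u v \<in> \<int>" "sum u C = 1"
      "(\<Sum>v\<in>C. u v *\<^sub>R v) = c"
    using unimodular_barycentric_Ints[of D c 2] D c by auto
  have fin: "finite C" using C(1) aff_independent_finite by blast
  have "sum (\<lambda>v. 2 * u v) C = 2" using u(3) by (simp flip: sum_distrib_left)
  then show thesis
  proof (cases rule: sum_two_Ints_cases[OF fin, of "\<lambda>v. 2 * u v", case_names nonneg ints sum one two])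
    case (one p)
    have "c = (\<Sum>v\<in>{p}. u v *\<^sub>R v)"
      unfolding u(4)[symmetric] using one fin by (intro sum.mono_neutral_right) auto
    then have "c = p" using one by simp
    then show thesis using one(1) C(3) c(3) by blast
  next
    case (two p q)
    have "c = (\<Sum>v\<in>{p, q}. u v *\<^sub>R v)"
      unfolding u(4)[symmetric] using two fin by (intro sum.mono_neutral_right) auto
    moreover have "u p = 1/2" "u q = 1/2" using two by auto
    ultimately have "c = midpoint p q" using two by (simp add: midpoint_def scaleR_add_right)
    moreover have "closed_segment p q face_of D"
      using C(1,2) two face_of_convex_hull_affine_independent[of C]
      by (metis empty_subsetI insert_subset segment_convex_hull)
    moreover have "p extreme_point_of D" "q extreme_point_of D"
      using C two extreme_point_of_convex_hull_affine_independent by blast+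
    ultimately show thesis using that two by blast
  qed (use u in auto)
qed

text \<open>Coordinate \<open>k\<close> is 0 at one end and 1 at the other, so along the segment it
  equals the parameter \<open>t\<close> or \<open>1 - t\<close>; at an integral point
  \<open>t\<close> is therefore 0 or 1.\<close>

lemma lattice_point_of_primitive_segment:
  fixes a p q :: "real^3"
  assumes a: "a \<in> closed_segment p q" "\<And>i. a $ i \<in> \<nat>" "\<And>i. p $ i \<in> \<nat>" "\<And>i. q $ i \<in> \<nat>"
    and sum: "p $ k + q $ k = 1"
  shows "a = p \<or> a = q"
proof -
  obtain t where t: "0 \<le> t" "t \<le> 1" "a = (1 - t) *\<^sub>R p + t *\<^sub>R q"
    using a(1) by (auto simp: in_segment)
  have "p $ k \<in> \<int>" using a(3) Nats_subset_Ints by blast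
  moreover have "0 \<le> p $ k" "p $ k \<le> 1" using a(3,4)[of k] sum Nats_altdef2 by (force simp: Nats_def)+
  ultimately have "p $ k = 0 \<or> p $ k = 1" by (auto elim!: Ints_cases)
  moreover have "q $ k = 1 - p $ k" using sum by simp
  moreover have "a $ k = (1 - t) * p $ k + t * q $ k" using t by simp
  ultimately have "t = a $ k \<or> t = 1 - a $ k" by auto
  moreover have "a $ k \<in> \<int>" using a(2) Nats_subset_Ints by blast
  ultimately have "t \<in> \<int>" by auto
  then have "t = 0 \<or> t = 1" using t by (auto elim!: Ints_cases)
  then show ?thesis using t by auto
qed

section \<open>The compact 2-cell of a smooth tropical quadric\<close>

theorem proposition7p1:
  fixes X A :: "(real^3) set" and lam :: "real^3 \<Rightarrow> real"
  assumes "smooth_tropical_surface 2 A lam X"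
  shows "(\<exists>!C. C \<in> tropical_cells A lam \<and> aff_dim C = 2 \<and> compact C) \<and>
    (\<forall>C. C \<in> tropical_cells A lam \<and> aff_dim C = 2 \<and> compact C \<longrightarrow>
      (\<exists>i j k :: 3. {i, j, k} = {1, 2, 3} \<and>
        normal_vector_of (- axis i 1 + axis j 1 + axis k 1) C))"
proof -
  define c :: "real^3" where "c = vec (1/2)"
  have fin: "finite A" and ne: "A \<noteq> {}" and nat: "\<And>a i. a \<in> A \<Longrightarrow> a $ i \<in> \<nat>"
    and hull: "convex hull A = Gamma_simplex 2" and uni: "unimodular_triangulation (Subdiv A lam)"
    using assms unfolding smooth_tropical_surface_def tropical_exponents_def newton_polytope_def
    by auto
  have Gam: "0 \<le> a $ i" "a $ 1 + a $ 2 + a $ 3 \<le> 2" if "a \<in> A" for a i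
  proof -
    have "a \<in> Gamma_simplex 2" using that hull hull_inc by metis
    then show "0 \<le> a $ i" "a $ 1 + a $ 2 + a $ 3 \<le> 2" by (auto simp: Gamma_simplex_iff)
  qed
  have cint: "c \<in> interior (convex hull A)"
    unfolding hull c_def by (rule half_interior_Gamma)
  have mid_c: "midpoint a b = c \<longleftrightarrow> (\<forall>i. a $ i + b $ i = 1)" for a b :: "real^3"
  proof -
    have "midpoint a b $ i = c $ i \<longleftrightarrow> a $ i + b $ i = 1" for i
      unfolding c_def midpoint_def vector_scaleR_component vector_add_component vec_component
        real_scaleR_def by auto
    then show ?thesis by (simp add: vec_eq_iff)
  qed

  have extA: "v \<in> A" if "D \<in> Subdiv A lam" "v extreme_point_of D" for D v
    using that Subdiv_hull[OF fin that(1)] extreme_point_of_convex_hull by (metis subsetD)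

  obtain D0 where "D0 \<in> Subdiv A lam" "c \<in> D0"
    using Subdiv_covers_interior[OF fin cint] .
  \<comment> \<open>Unimodularity is given for maximal cells, so \<open>D0\<close> is enlarged to a
    maximal one.\<close>
  then obtain D where D: "D \<in> Subdiv A lam" "c \<in> D" "unimodular_tetrahedron D"
    using finite_has_maximal2[OF finite_Subdiv[OF fin]] uni
    unfolding unimodular_triangulation_def by (metis subsetD)
  have "c $ 1 \<notin> \<int>"
  proof
    assume "c $ 1 \<in> \<int>"
    then obtain m where "(1/2 :: real) = of_int m" by (auto simp: c_def elim: Ints_cases)
    then have "of_int (2 * m) = (of_int 1 :: real)" by simp
    then show False by (simp only: of_int_eq_iff) presburger
  qed
  then obtain p q where pq: "p extreme_point_of D" "q extreme_point_of D" "p \<noteq> q"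
      "c = midpoint p q" and face: "closed_segment p q face_of D"
    using unimodular_half_lattice_point[OF D(3,2)] by (auto simp: c_def)
  have pqA: "p \<in> A" "q \<in> A" using extA D(1) pq by blast+
  have pq1: "p $ i + q $ i = 1" for i using mid_c pq(4) by metis
  have segS: "closed_segment p q \<in> Subdiv A lam"
    using face_of_Subdiv[OF fin ne D(1) face] by simp
  then obtain x where x: "closed_segment p q = convex hull (active A lam x)"
    using Subdiv_iff[OF fin ne] by blast
  \<comment> \<open>The hull alone would permit further dominant exponents inside the segment; the
    coordinate sums equal to 1 exclude them.\<close>
  have act: "active A lam x = {p, q}"
  proof
    show "active A lam x \<subseteq> {p, q}"
    proof
      fix a assume a: "a \<in> active A lam x"
      then have "a \<in> closed_segment p q" using x by (simp add: hull_inc)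
      moreover have "a \<in> A" using a by (simp add: active_def)
      ultimately show "a \<in> {p, q}"
        using lattice_point_of_primitive_segment[OF _ _ _ _ pq1] nat pqA by blast
    qed
    show "{p, q} \<subseteq> active A lam x"
      using x extreme_point_of_segment extreme_point_of_convex_hull
      by (metis empty_subsetI insert_subset)
  qed
  define C0 where "C0 = dual_cell A lam (closed_segment p q)"
  have dim0: "aff_dim C0 = 2"
    unfolding C0_def by (rule aff_dim_dual_cell_segment[OF fin pq(3) act])
  have C0: "C0 \<in> tropical_cells A lam"
    unfolding C0_def tropical_cells_def using segS pq(3)
    by (auto simp: segment_convex_hull aff_dim_convex_hull aff_dim_2)
  have comp0: "compact C0"
    unfolding C0_def dual_cell_segment_midpoint[OF pqA] pq(4)[symmetric]
    by (rule compact_dominating_region[OF fin cint])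

  have unique: "C = C0" if C: "C \<in> tropical_cells A lam" "aff_dim C = 2" "compact C" for C
  proof -
    obtain D where D: "D \<in> Subdiv A lam" "aff_dim D \<ge> 1" "C = dual_cell A lam D"
      using C(1) by (auto simp: tropical_cells_def)
    obtain B where B: "B \<subseteq> A" "D = convex hull B" using Subdiv_hull[OF fin D(1)] .
    have "D \<noteq> {}" "C \<noteq> {}" using D(2) C(2) by auto
    have cD: "compact D" "convex D"
      using B fin finite_subset by (auto intro: finite_imp_compact_convex_hull)
    \<comment> \<open>Complementary dimensions force the set dual to a 2-cell to be a
      segment.\<close>
    have "aff_dim D \<le> 1"
      using aff_dim_dual_cell_le[OF cD \<open>D \<noteq> {}\<close>, of A lam] C(2) D(3) \<open>C \<noteq> {}\<close> by simp
    then have "collinear D" by (simp add: collinear_aff_dim)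
    then obtain a b where seg: "D = closed_segment a b"
      using compact_convex_collinear_segment[OF \<open>D \<noteq> {}\<close> cD] by blast
    have ab: "a \<in> A" "b \<in> A"
      using extA[OF D(1)] by (auto simp: seg extreme_point_of_segment)
    \<comment> \<open>No facet contains both ends: its outer normal \<open>n\<close> would make the
      cell unbounded.\<close>
    have facet: "n = 0" if "n \<bullet> a = n \<bullet> b" "\<And>d. d \<in> A \<Longrightarrow> n \<bullet> d \<le> n \<bullet> a" for n
      using dual_cell_segment_bounded_imp[of A lam a b n] that C(3) \<open>C \<noteq> {}\<close> D(3) seg
        compact_imp_bounded by blast
    have coord: "a $ i + b $ i \<ge> 1" for i
    proof (rule ccontr)
      assume "\<not> ?thesis"
      moreover obtain k l where "a $ i = real k" "b $ i = real l"
        using nat[OF ab(1), of i] nat[OF ab(2), of i] by (auto elim!: Nats_cases)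
      ultimately have "a $ i = 0" "b $ i = 0" by auto
      \<comment> \<open>Outer normal of the facet on which coordinate \<open>i\<close>
        vanishes.\<close>
      then have "- axis i 1 = (0 :: real^3)"
        using Gam(1) by (intro facet) (auto simp: inner_axis')
      then show False by simp
    qed
    have total: "a $ 1 + a $ 2 + a $ 3 + (b $ 1 + b $ 2 + b $ 3) \<le> 3"
    proof (rule ccontr)
      assume asm: "\<not> ?thesis"
      define ka where "ka = a $ 1 + a $ 2 + a $ 3"
      define kb where "kb = b $ 1 + b $ 2 + b $ 3"
      have "ka \<in> \<nat>" "kb \<in> \<nat>" using nat ab by (auto simp: ka_def kb_def)
      then obtain k l where "ka = real k" "kb = real l" by (auto elim!: Nats_cases)
      moreover have "ka \<le> 2" "kb \<le> 2" "ka + kb > 3"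
        using Gam(2) ab asm by (auto simp: ka_def kb_def)
      ultimately have "ka = 2" "kb = 2" by auto
      \<comment> \<open>Outer normal of the slanted facet, on which the coordinates add up to
        2.\<close>
      then have "vec 1 = (0 :: real^3)"
        using Gam(2) by (intro facet) (auto simp: inner_vec_def sum_3 ka_def kb_def)
      then show False by (simp add: vec_eq_iff)
    qed
    \<comment> \<open>Three sums that are each at least 1 and together at most 3.\<close>
    have "a $ i + b $ i = 1" for i
      using coord[of 1] coord[of 2] coord[of 3] total exhaust_3[of i] by auto
    then have "midpoint a b = midpoint p q" using mid_c pq(4) by metis
    moreover have "C0 \<noteq> {}" using dim0 by auto
    ultimately show "C = C0"
      using dual_cell_segment_eqI[OF ab pqA] \<open>C \<noteq> {}\<close> D(3) seg C0_def by metis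
  qed

  have normal: "\<exists>i j k :: 3. {i, j, k} = {1, 2, 3} \<and>
      normal_vector_of (- axis i 1 + axis j 1 + axis k 1) C0"
  proof -
    \<comment> \<open>The terms of \<open>p\<close> and \<open>q\<close> agree on \<open>C0\<close>,
      so \<open>p - q\<close> is normal to it. Both signs are kept, as either end may be the unit
      vector.\<close>
    have n: "normal_vector_of v C0" if "v = p - q \<or> v = q - p" for v
    proof -
      have orth: "(p - q) \<bullet> (y - z) = 0" if "y \<in> C0" "z \<in> C0" for y z
        using that
        by (auto simp: C0_def dual_cell_segment trop_term_def inner_diff)
      have "v \<noteq> 0" using that pq(3) by auto
      moreover have "v = p - q \<or> v = - (p - q)" using that by simp
      ultimately show ?thesis
        unfolding normal_vector_of_def using orth inner_minus_left[of "p - q"] by fastforce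
    qed
    have bit: "p $ i = 0 \<and> q $ i = 1 \<or> p $ i = 1 \<and> q $ i = 0" for i
    proof -
      obtain k l where "p $ i = real k" "q $ i = real l"
        using nat[OF pqA(1), of i] nat[OF pqA(2), of i] by (auto elim!: Nats_cases)
      then show ?thesis using pq1[of i] by auto
    qed
    have le: "p $ 1 + p $ 2 + p $ 3 \<le> 2" "q $ 1 + q $ 2 + q $ 3 \<le> 2" using Gam(2) pqA by auto
    \<comment> \<open>By \<open>bit\<close>, \<open>p\<close> and \<open>q\<close> are complementary
      0/1 vectors. Neither has coordinate sum 3, so one is a unit vector and the other the sum of
      the remaining two; the three choices of unit vector give the three cases.\<close>
    define w :: "3 \<Rightarrow> 3 \<Rightarrow> 3 \<Rightarrow> real^3" where "w i j k = - axis i 1 + axis j 1 + axis k 1" for i j k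
    have "(w 1 2 3 = p - q \<or> w 1 2 3 = q - p) \<or> (w 2 1 3 = p - q \<or> w 2 1 3 = q - p)
       \<or> (w 3 1 2 = p - q \<or> w 3 1 2 = q - p)"
      using bit[of 1] bit[of 2] bit[of 3] le
      by (elim disjE) (simp_all add: w_def vec_eq_iff forall_3 axis_def)
    then have "normal_vector_of (w 1 2 3) C0 \<or> normal_vector_of (w 2 1 3) C0 \<or>
        normal_vector_of (w 3 1 2) C0"
      using n by blast
    then show ?thesis
    proof (elim disjE)
      assume "normal_vector_of (w 1 2 3) C0"
      then show ?thesis unfolding w_def by (intro exI[of _ 1] exI[of _ 2] exI[of _ 3] conjI refl)
    next
      assume "normal_vector_of (w 2 1 3) C0"
      then show ?thesis unfolding w_def
        by (intro exI[of _ 2] exI[of _ 1] exI[of _ 3] conjI insert_commute)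
    next
      assume "normal_vector_of (w 3 1 2) C0"
      moreover have "{3, 1, 2} = {1, 2, 3 :: 3}" by blast
      ultimately show ?thesis unfolding w_def
        by (intro exI[of _ 3] exI[of _ 1] exI[of _ 2] conjI)
    qed
  qed
  show ?thesis
  proof (intro conjI allI impI ex1I[of _ C0])
    fix C assume "C \<in> tropical_cells A lam \<and> aff_dim C = 2 \<and> compact C"
    then show "C = C0" using unique by blast
    then show "\<exists>i j k :: 3. {i, j, k} = {1, 2, 3} \<and>
        normal_vector_of (- axis i 1 + axis j 1 + axis k 1) C"
      using normal by (simp only:)
  qed (use C0 dim0 comp0 in auto)
qed

end
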